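(* Let $S$ be a topological space. (1) The frame $N(\mathcal{O}S)$ of nuclei on $\mathcal{O}S$ is spatial if and only if the soberification of $S$ is weakly scattered. (2) If $S$ is $T_0$, then the following equivalence holds: ($S$ is sober and $N(\mathcal{O}S)$ is spatial) if and only if $S$ is weakly scattered. In particular, if $S$ is sober, then $N(\mathcal{O}S)$ is spatial if and only if $S$ is weakly scattered.
   Context: $\mathcal{O}S$ denotes the frame of open sets of $S$. A frame is a complete lattice $L$ satisfying $a\wedge\bigvee A=\bigvee\{a\wedge s\mid s\in A\}$ for all $a\in L$ and $A\subseteq L$; it is spatial if it is isomorphic to the frame of open sets of some topological space. A nucleus on a frame $L$ is a map $j:L\to L$ with $a\le ja$, $jja\le ja$, and $j(a\wedge b)=ja\wedge jb$ for all $a,b\in L$. $N(L)$ is the set of all nuclei on $L$ ordered by $j\le k$ iff $ja\le ka$ for all $a\in L$; it is a frame. A completely prime filter of a frame $L$ is a proper filter $x$ of $L$ such that $\bigvee A\in x$ implies $A\cap x\neq\varnothing$ for each $A\subseteq L$. The soberification of $S$ is the space $\mathsf{pt}(\mathcal{O}S)$ of completely prime filters of $\mathcal{O}S$, with open sets $\{x\in\mathsf{pt}(\mathcal{O}S)\mid U\in x\}$ for $U\in\mathcal{O}S$. The space $S$ is sober if the map $\varepsilon:S\to\mathsf{pt}(\mathcal{O}S)$ given by $\varepsilon(s)=\{U\in\mathcal{O}S\mid s\in U\}$ is a homeomorphism; equivalently, if each irreducible closed set of $S$ is the closure of a unique point. For a topological space $S$ and a subspace $T$, a point $x\in T$ is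 weakly isolated in $T$ if there is an open subset $U$ of $S$ with $x\in T\cap U\subseteq\overline{\{x\}}$ (closure in $S$). $S$ is weakly scattered if each nonempty closed subspace of $S$ has a weakly isolated point. *)

theory Defs
  imports "HOL-Analysis.Abstract_Topological_Spaces" "HOL-Algebra.Complete_Lattice"
begin

section \<open>Frames\<close>

locale frame = complete_lattice L for L :: "'a gorder" (structure) +
  assumes inf_Sup_distrib:
    "\<lbrakk>a \<in> carrier L; A \<subseteq> carrier L\<rbrakk> \<Longrightarrow> a \<sqinter> \<Squnion>A = \<Squnion>((\<lambda>s. a \<sqinter> s) ` A)"

definition opens :: "'a topology \<Rightarrow> 'a set gorder" where
  "opens S = \<lparr>carrier = {U. openin S U}, eq = (=), le = (\<subseteq>)\<rparr>"

text \<open>The order determines the frame operations, so an isomorphism of frames is an isomorphism of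
  the underlying posets.\<close>

definition frame_iso :: "'a gorder \<Rightarrow> 'b gorder \<Rightarrow> ('a \<Rightarrow> 'b) \<Rightarrow> bool" where
  "frame_iso L M f \<longleftrightarrow> order_emb L M f \<and> bij_betw f (carrier L) (carrier M)"

text \<open>HOL cannot quantify over the type of the points of the representing space. Taking the points
  to be sets of elements of \<open>L\<close> is no restriction: \<open>spatialI\<close> below shows that a space on any
  type will do.\<close>

definition spatial :: "'a gorder \<Rightarrow> bool" where
  "spatial L \<longleftrightarrow> frame L \<and> (\<exists>(X :: 'a set topology) f. frame_iso L (opens X) f)"

section \<open>Nuclei\<close>

text \<open>The maps are taken extensional on \<open>carrier L\<close>, so that the pointwise order is antisymmetric.\<close>

definition nuclei :: "'a gorder \<Rightarrow> ('a \<Rightarrow> 'a) gorder" where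
  "nuclei L =
    \<lparr>carrier = {j \<in> carrier L \<rightarrow>\<^sub>E carrier L.
       (\<forall>a\<in>carrier L. a \<sqsubseteq>\<^bsub>L\<^esub> j a) \<and>
       (\<forall>a\<in>carrier L. j (j a) \<sqsubseteq>\<^bsub>L\<^esub> j a) \<and>
       (\<forall>a\<in>carrier L. \<forall>b\<in>carrier L. j (a \<sqinter>\<^bsub>L\<^esub> b) = j a \<sqinter>\<^bsub>L\<^esub> j b)},
     eq = (=),
     le = (\<lambda>j k. \<forall>a\<in>carrier L. j a \<sqsubseteq>\<^bsub>L\<^esub> k a)\<rparr>"

section \<open>Points and sobriety\<close>

definition proper_filter :: "'a gorder \<Rightarrow> 'a set \<Rightarrow> bool" where
  "proper_filter L x \<longleftrightarrow> x \<subset> carrier L \<and> x \<noteq> {} \<and>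
     (\<forall>a\<in>x. \<forall>b\<in>carrier L. a \<sqsubseteq>\<^bsub>L\<^esub> b \<longrightarrow> b \<in> x) \<and>
     (\<forall>a\<in>x. \<forall>b\<in>x. a \<sqinter>\<^bsub>L\<^esub> b \<in> x)"

definition completely_prime_filter :: "'a gorder \<Rightarrow> 'a set \<Rightarrow> bool" where
  "completely_prime_filter L x \<longleftrightarrow> proper_filter L x \<and>
     (\<forall>A \<subseteq> carrier L. \<Squnion>\<^bsub>L\<^esub>A \<in> x \<longrightarrow> A \<inter> x \<noteq> {})"

text \<open>For a frame \<open>L\<close> the sets in the range below do form a topology; see \<open>openin_pt\<close>.\<close>

definition pt :: "'a gorder \<Rightarrow> 'a set topology" where
  "pt L = topology (\<lambda>V. \<exists>a\<in>carrier L. V = {x. completely_prime_filter L x \<and> a \<in> x})"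

definition soberification :: "'a topology \<Rightarrow> 'a set set topology" where
  "soberification S = pt (opens S)"

definition sober :: "'a topology \<Rightarrow> bool" where
  "sober S \<longleftrightarrow> homeomorphic_map S (soberification S) (\<lambda>s. {U. openin S U \<and> s \<in> U})"

section \<open>Weakly scattered spaces\<close>

definition weakly_isolated_in :: "'a topology \<Rightarrow> 'a set \<Rightarrow> 'a \<Rightarrow> bool" where
  "weakly_isolated_in S T x \<longleftrightarrow> x \<in> T \<and>
     (\<exists>U. openin S U \<and> x \<in> T \<inter> U \<and> T \<inter> U \<subseteq> S closure_of {x})"

definition weakly_scattered :: "'a topology \<Rightarrow> bool" where
  "weakly_scattered S \<longleftrightarrow> (\<forall>F. closedin S F \<and> F \<noteq> {} \<longrightarrow> (\<exists>x. weakly_isolated_in S F x))"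

section \<open>Well-definedness\<close>

lemma carrier_opens [simp]: "carrier (opens S) = {U. openin S U}"
  and eq_opens [simp]: "(.=\<^bsub>opens S\<^esub>) = (=)"
  and le_opens [simp]: "(\<sqsubseteq>\<^bsub>opens S\<^esub>) = (\<subseteq>)"
  by (simp_all add: opens_def)

interpretation opens: complete_lattice "opens S"
proof -
  interpret partial_order "opens S"
    by unfold_locales auto
  show "complete_lattice (opens S)"
  proof (rule complete_latticeI)
    fix A assume A: "A \<subseteq> carrier (opens S)"
    then have "least (opens S) (\<Union>A) (Upper (opens S) A)"
      by (auto simp: least_def Upper_def)
    then show "\<exists>s. least (opens S) s (Upper (opens S) A)" ..
    have "greatest (opens S) (S interior_of (topspace S \<inter> \<Inter>A)) (Lower (opens S) A)"
    proof -
      have lower: "S interior_of (topspace S \<inter> \<Inter>A) \<subseteq> X" if "X \<in> A" for X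
        using interior_of_subset[of S "topspace S \<inter> \<Inter>A"] that by blast
      have max: "U \<subseteq> S interior_of (topspace S \<inter> \<Inter>A)"
        if "openin S U" "\<forall>X\<in>A. U \<subseteq> X" for U
        using that openin_subset[of S U] by (intro interior_of_maximal) auto
      show ?thesis
      proof (intro greatest_LowerI)
        fix U assume "U \<in> Lower (opens S) A"
        then have "openin S U" "\<forall>X\<in>A. U \<subseteq> X"
          using A by (auto simp: Lower_def)
        with max show "U \<sqsubseteq>\<^bsub>opens S\<^esub> S interior_of (topspace S \<inter> \<Inter>A)"
          by simp
      qed (use A lower in auto)
    qed
    then show "\<exists>i. greatest (opens S) i (Lower (opens S) A)" ..
  qed
qed

lemma sup_opens: "A \<subseteq> {U. openin S U} \<Longrightarrow> \<Squnion>\<^bsub>opens S\<^esub>A = \<Union>A"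
proof -
  assume A: "A \<subseteq> {U. openin S U}"
  then have "least (opens S) (\<Union>A) (Upper (opens S) A)"
    by (auto simp: least_def Upper_def)
  then show ?thesis
    using opens.sup_lub[of A S] A opens.least_unique by fastforce
qed

lemma meet_opens: "openin S U \<Longrightarrow> openin S V \<Longrightarrow> U \<sqinter>\<^bsub>opens S\<^esub> V = U \<inter> V"
proof -
  assume UV: "openin S U" "openin S V"
  then have "greatest (opens S) (U \<inter> V) (Lower (opens S) {U, V})"
    by (auto simp: greatest_def Lower_def)
  then show ?thesis
    using opens.inf_glb[of "{U, V}" S] UV opens.greatest_unique by (fastforce simp: meet_def)
qed

lemma frame_opens: "frame (opens S)"
proof
  fix a A assume a: "a \<in> carrier (opens S)" and A: "A \<subseteq> carrier (opens S)"
  then have meets: "(\<lambda>s. a \<sqinter>\<^bsub>opens S\<^esub> s) ` A = (\<lambda>s. a \<inter> s) ` A"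
    by (auto simp: meet_opens subset_iff intro!: image_cong)
  have "(\<lambda>s. a \<inter> s) ` A \<subseteq> {U. openin S U}"
    using a A by auto
  then have "\<Squnion>\<^bsub>opens S\<^esub>((\<lambda>s. a \<inter> s) ` A) = a \<inter> \<Union>A"
    by (subst sup_opens) auto
  moreover have "a \<sqinter>\<^bsub>opens S\<^esub> \<Squnion>\<^bsub>opens S\<^esub>A = a \<inter> \<Union>A"
    using a A openin_Union[of A S] by (subst sup_opens) (auto intro!: meet_opens)
  ultimately show "a \<sqinter>\<^bsub>opens S\<^esub> \<Squnion>\<^bsub>opens S\<^esub>A = \<Squnion>\<^bsub>opens S\<^esub>((\<lambda>s. a \<sqinter>\<^bsub>opens S\<^esub> s) ` A)"
    unfolding meets by simp
qed

lemma (in frame) proper_filter_meet: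
  assumes "proper_filter L x" "a \<in> carrier L" "b \<in> carrier L"
  shows "a \<sqinter> b \<in> x \<longleftrightarrow> a \<in> x \<and> b \<in> x"
proof
  have up: "d \<in> x" if "c \<in> x" "d \<in> carrier L" "c \<sqsubseteq> d" for c d
    using assms(1) that unfolding proper_filter_def by blast
  show "a \<in> x \<and> b \<in> x" if "a \<sqinter> b \<in> x"
    using up[OF that] assms(2,3) meet_left meet_right by blast
  show "a \<sqinter> b \<in> x" if "a \<in> x \<and> b \<in> x"
    using assms(1) that unfolding proper_filter_def by blast
qed

lemma (in frame) completely_prime_filter_sup:
  assumes "completely_prime_filter L x" "A \<subseteq> carrier L"
  shows "\<Squnion>A \<in> x \<longleftrightarrow> A \<inter> x \<noteq> {}"
proof
  show "A \<inter> x \<noteq> {}" if "\<Squnion>A \<in> x"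
    using that assms by (auto simp: completely_prime_filter_def)
  assume "A \<inter> x \<noteq> {}"
  then obtain a where a: "a \<in> A" "a \<in> x" by blast
  have "a \<sqsubseteq> \<Squnion>A" "\<Squnion>A \<in> carrier L"
    using assms(2) a(1) by (auto intro: sup_upper)
  then show "\<Squnion>A \<in> x"
    using assms(1) a(2) unfolding completely_prime_filter_def proper_filter_def by blast
qed

lemma (in frame) istopology_pt:
  "istopology (\<lambda>V. \<exists>a\<in>carrier L. V = {x. completely_prime_filter L x \<and> a \<in> x})"
  unfolding istopology_def
proof (intro conjI allI impI)
  fix V W
  assume "\<exists>a\<in>carrier L. V = {x. completely_prime_filter L x \<and> a \<in> x}"
    and "\<exists>a\<in>carrier L. W = {x. completely_prime_filter L x \<and> a \<in> x}"
  then obtain a b where ab: "a \<in> carrier L" "V = {x. completely_prime_filter L x \<and> a \<in> x}"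
      "b \<in> carrier L" "W = {x. completely_prime_filter L x \<and> b \<in> x}"
    by blast
  then have "V \<inter> W = {x. completely_prime_filter L x \<and> a \<sqinter> b \<in> x}"
    by (auto simp: completely_prime_filter_def proper_filter_meet)
  with ab show "\<exists>c\<in>carrier L. V \<inter> W = {x. completely_prime_filter L x \<and> c \<in> x}"
    by (meson meet_closed)
next
  fix \<K>
  assume K: "\<forall>K\<in>\<K>. \<exists>a\<in>carrier L. K = {x. completely_prime_filter L x \<and> a \<in> x}"
  define A where "A = {a \<in> carrier L. {x. completely_prime_filter L x \<and> a \<in> x} \<in> \<K>}"
  have A: "A \<subseteq> carrier L" by (auto simp: A_def)
  have "\<Union>\<K> = {x. completely_prime_filter L x \<and> A \<inter> x \<noteq> {}}"
  proof (intro subset_antisym subsetI)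
    fix x assume "x \<in> \<Union>\<K>"
    then obtain V where V: "V \<in> \<K>" "x \<in> V" by blast
    then obtain a where "a \<in> carrier L" "V = {x. completely_prime_filter L x \<and> a \<in> x}"
      using K by blast
    with V show "x \<in> {x. completely_prime_filter L x \<and> A \<inter> x \<noteq> {}}"
      by (auto simp: A_def)
  next
    fix x assume "x \<in> {x. completely_prime_filter L x \<and> A \<inter> x \<noteq> {}}"
    then obtain a where "completely_prime_filter L x" "a \<in> A" "a \<in> x" by blast
    then show "x \<in> \<Union>\<K>"
      unfolding A_def by blast
  qed
  also have "\<dots> = {x. completely_prime_filter L x \<and> \<Squnion>A \<in> x}"
    using completely_prime_filter_sup[OF _ A] by (intro Collect_cong) auto
  finally show "\<exists>c\<in>carrier L. \<Union>\<K> = {x. completely_prime_filter L x \<and> c \<in> x}"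
    using sup_closed[OF A] by (intro bexI)
qed

lemma (in frame) openin_pt:
  "openin (pt L) V \<longleftrightarrow> (\<exists>a\<in>carrier L. V = {x. completely_prime_filter L x \<and> a \<in> x})"
  by (simp add: pt_def topology_inverse'[OF istopology_pt])

lemma (in frame) topspace_pt: "topspace (pt L) = {x. completely_prime_filter L x}"
proof -
  have "\<top> \<in> x" if "completely_prime_filter L x" for x
  proof -
    have "x \<subseteq> carrier L" "x \<noteq> {}"
      using that by (auto simp: completely_prime_filter_def proper_filter_def)
    then obtain a where "a \<in> x" "a \<in> carrier L" by blast
    then show ?thesis
      using that top_closed top_higher[of a]
      unfolding completely_prime_filter_def proper_filter_def by blast
  qed
  then have "openin (pt L) {x. completely_prime_filter L x}"
    unfolding openin_pt by (intro bexI[of _ \<top>]) auto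
  then show ?thesis
    using openin_topspace[of "pt L"] openin_subset[of "pt L"] unfolding openin_pt[of "topspace (pt L)"]
    by blast
qed

lemma spatialI:
  fixes L :: "'a gorder" (structure) and X :: "'b topology"
  assumes "frame L" and iso: "frame_iso L (opens X) f"
  shows "spatial L"
proof -
  interpret frame L by fact
  have emb: "a \<sqsubseteq>\<^bsub>L\<^esub> b \<longleftrightarrow> f a \<subseteq> f b" if "a \<in> carrier L" "b \<in> carrier L" for a b
    using iso that by (auto simp: frame_iso_def order_emb_def)
  have bij: "bij_betw f (carrier L) {U. openin X U}"
    using iso by (simp add: frame_iso_def)
  have op: "openin X (f a)" if "a \<in> carrier L" for a
    using bij that by (auto simp: bij_betw_def)
  have surj: "\<exists>a\<in>carrier L. f a = U" if "openin X U" for U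
  proof -
    have "U \<in> f ` carrier L" using bij that by (simp add: bij_betw_def)
    then show ?thesis by blast
  qed
  have f_meet: "f (a \<sqinter> b) = f a \<inter> f b" if ab: "a \<in> carrier L" "b \<in> carrier L" for a b
  proof
    show "f (a \<sqinter> b) \<subseteq> f a \<inter> f b"
      using ab meet_left[of a b] meet_right[of a b] emb[of "a \<sqinter> b" a] emb[of "a \<sqinter> b" b] by simp
    obtain c where c: "c \<in> carrier L" "f c = f a \<inter> f b"
      using surj[of "f a \<inter> f b"] op ab by auto
    then have "c \<sqsubseteq> a \<sqinter> b"
      using ab by (intro meet_le) (auto simp: emb)
    then show "f a \<inter> f b \<subseteq> f (a \<sqinter> b)"
      using c ab emb[of c "a \<sqinter> b"] by simp
  qed
  have f_sup: "f (\<Squnion>A) = \<Union>(f ` A)" if A: "A \<subseteq> carrier L" for A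
  proof
    have "openin X (\<Union>(f ` A))"
      using op A by (intro openin_Union) auto
    then obtain c where c: "c \<in> carrier L" "f c = \<Union>(f ` A)"
      using surj by blast
    then have "\<Squnion>A \<sqsubseteq> c"
      using A emb[of _ c] by (intro sup_least) (auto simp: subset_iff)
    then show "f (\<Squnion>A) \<subseteq> \<Union>(f ` A)"
      using c emb[of "\<Squnion>A" c] sup_closed[OF A] by simp
    show "\<Union>(f ` A) \<subseteq> f (\<Squnion>A)"
    proof (rule UN_least)
      fix a assume "a \<in> A"
      then show "f a \<subseteq> f (\<Squnion>A)"
        using A emb[of a "\<Squnion>A"] sup_upper[OF A] sup_closed[OF A] by blast
    qed
  qed
  define P where "P s = {a \<in> carrier L. s \<in> f a}" for s
  define \<phi> where "\<phi> a = {x. completely_prime_filter L x \<and> a \<in> x}" for a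
  have cpf: "completely_prime_filter L (P s)" if s: "s \<in> topspace X" for s
  proof -
    obtain t where t: "t \<in> carrier L" "f t = topspace X"
      using surj[of "topspace X"] by auto
    obtain b where b: "b \<in> carrier L" "f b = {}"
      using surj[of "{}"] by auto
    show ?thesis
      unfolding completely_prime_filter_def proper_filter_def
    proof (intro conjI ballI allI impI)
      show "P s \<subset> carrier L" using b by (auto simp: P_def)
      show "P s \<noteq> {}" using t s by (auto simp: P_def)
    next
      fix a b assume "a \<in> P s" "b \<in> carrier L" "a \<sqsubseteq> b"
      then show "b \<in> P s" using emb[of a b] by (auto simp: P_def)
    next
      fix a b assume "a \<in> P s" "b \<in> P s"
      then show "a \<sqinter> b \<in> P s" by (auto simp: P_def f_meet)
    next
      fix A assume "A \<subseteq> carrier L" "\<Squnion>A \<in> P s"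
      then show "A \<inter> P s \<noteq> {}" by (auto simp: P_def f_sup)
    qed
  qed
  have emb': "\<phi> a \<subseteq> \<phi> b \<longleftrightarrow> a \<sqsubseteq> b" if ab: "a \<in> carrier L" "b \<in> carrier L" for a b
  proof
    assume "a \<sqsubseteq> b"
    then show "\<phi> a \<subseteq> \<phi> b"
      using ab by (auto simp: \<phi>_def completely_prime_filter_def proper_filter_def)
  next
    assume *: "\<phi> a \<subseteq> \<phi> b"
    have "f a \<subseteq> f b"
    proof
      fix s assume s: "s \<in> f a"
      then have "s \<in> topspace X" using op[OF ab(1)] openin_subset by blast
      then have "P s \<in> \<phi> a" using cpf s ab by (auto simp: \<phi>_def P_def)
      with * have "b \<in> P s" by (auto simp: \<phi>_def)
      then show "s \<in> f b" by (simp add: P_def)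
    qed
    then show "a \<sqsubseteq> b" using emb[of a b] ab by blast
  qed
  have "inj_on \<phi> (carrier L)"
    by (intro inj_onI le_antisym) (simp_all flip: emb')
  moreover have "\<phi> ` carrier L = {V. openin (pt L) V}"
    by (auto simp: openin_pt \<phi>_def)
  ultimately have "frame_iso L (opens (pt L)) \<phi>"
    using emb' weak_partial_order_axioms opens.weak_partial_order_axioms
    by (auto simp: frame_iso_def order_emb_def bij_betw_def)
  then show ?thesis
    unfolding spatial_def by (intro conjI exI) (rule \<open>frame L\<close>)
qed

end

theory Submission
  imports Defs
begin

text \<open>For a point \<open>x\<close> of \<open>\<O>S\<close> let \<open>P\<close> be the largest open set not in \<open>x\<close>. A nucleus \<open>j\<close> determines the
  Skula-open set of those \<open>x\<close> with \<open>j P \<in> x\<close>. Every Skula-open set arises in this way, and \<open>j\<close> can be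
  recovered from it when the soberification is weakly scattered: if \<open>j U \<subseteq> k U\<close> fails, a weakly
  isolated point of the complement of the implication \<open>j U \<rightarrow> k U\<close> separates \<open>j\<close> from \<open>k\<close>.

  Conversely, if the frame of nuclei is spatial and \<open>j\<close> is not the top, a point of that frame
  avoiding \<open>j\<close> restricts along closed nuclei to a point \<open>x\<close> of \<open>\<O>S\<close> with \<open>j P = P\<close>. For \<open>j\<close> the
  double negation relative to an open set \<open>B\<close>, this \<open>x\<close> is weakly isolated in the closed set of
  points not containing \<open>B\<close>.\<close>

section \<open>Completely prime filters of open sets\<close>

text \<open>Joins and meets become unions and intersections. On the right, upward closure is
  contained in the equivalence for intersections, and properness comes from the empty family, whose
  union is \<open>{}\<close>.\<close>

lemma completely_prime_filter_opens:
  "completely_prime_filter (opens S) x \<longleftrightarrow>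
    x \<subseteq> {U. openin S U} \<and> topspace S \<in> x \<and>
    (\<forall>U V. openin S U \<longrightarrow> openin S V \<longrightarrow> (U \<inter> V \<in> x \<longleftrightarrow> U \<in> x \<and> V \<in> x)) \<and>
    (\<forall>A \<subseteq> {U. openin S U}. \<Union>A \<in> x \<longrightarrow> A \<inter> x \<noteq> {})" (is "?l \<longleftrightarrow> ?r")
proof
  interpret frame "opens S" by (rule frame_opens)
  assume l: ?l
  then have p: "proper_filter (opens S) x"
    by (simp add: completely_prime_filter_def)
  then obtain U where U: "openin S U" "U \<in> x"
    by (auto simp: proper_filter_def)
  have "topspace S \<in> x"
    using p U openin_subset[OF U(1)] by (auto simp: proper_filter_def)
  moreover have "U \<inter> V \<in> x \<longleftrightarrow> U \<in> x \<and> V \<in> x" if "openin S U" "openin S V" for U V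
    using proper_filter_meet[OF p] that by (simp add: meet_opens)
  moreover have "A \<inter> x \<noteq> {}" if "A \<subseteq> {U. openin S U}" "\<Union>A \<in> x" for A
    using l that by (auto simp: completely_prime_filter_def sup_opens)
  ultimately show ?r
    using p by (simp add: proper_filter_def psubset_eq)
next
  assume r: ?r
  have "{} \<notin> x"
    using r by (metis Int_empty_left Union_empty empty_subsetI)
  moreover have "V \<in> x" if "U \<in> x" "openin S V" "U \<subseteq> V" for U V
    using r that by (metis Int_absorb2 mem_Collect_eq subsetD)
  moreover have "U \<sqinter>\<^bsub>opens S\<^esub> V \<in> x" if "U \<in> x" "V \<in> x" for U V
  proof -
    have "openin S U" "openin S V"
      using r that by auto
    then show ?thesis
      using r that by (simp add: meet_opens)
  qed
  moreover have "x \<subset> {U. openin S U}" "x \<noteq> {}"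
    using r \<open>{} \<notin> x\<close> openin_empty[of S] by blast+
  moreover have "A \<inter> x \<noteq> {}" if "A \<subseteq> {U. openin S U}" "\<Squnion>\<^bsub>opens S\<^esub>A \<in> x" for A
    using r that by (simp add: sup_opens)
  ultimately show ?l
    by (simp add: completely_prime_filter_def proper_filter_def)
qed

context
  fixes S :: "'a topology" and x
  assumes x: "completely_prime_filter (opens S) x"
begin

lemma cpf_open: "U \<in> x \<Longrightarrow> openin S U"
  using x by (auto simp: completely_prime_filter_opens)

lemma cpf_topspace: "topspace S \<in> x"
  using x by (auto simp: completely_prime_filter_opens)

lemma cpf_Int: "openin S U \<Longrightarrow> openin S V \<Longrightarrow> U \<inter> V \<in> x \<longleftrightarrow> U \<in> x \<and> V \<in> x"
  using x by (simp add: completely_prime_filter_opens)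

lemma cpf_mono: "U \<in> x \<Longrightarrow> openin S V \<Longrightarrow> U \<subseteq> V \<Longrightarrow> V \<in> x"
  using cpf_Int[of U V] cpf_open[of U] by (simp add: Int_absorb2)

lemma cpf_Union: "A \<subseteq> {U. openin S U} \<Longrightarrow> \<Union>A \<in> x \<Longrightarrow> \<exists>U\<in>A. U \<in> x"
  using x unfolding completely_prime_filter_opens by blast

end

lemma cpf_neighbourhoods:
  assumes "s \<in> topspace S"
  shows "completely_prime_filter (opens S) {U. openin S U \<and> s \<in> U}"
  using assms by (auto simp: completely_prime_filter_opens)

definition prime_open :: "'a topology \<Rightarrow> 'a set set \<Rightarrow> 'a set" where
  "prime_open S x = \<Union>{U. openin S U \<and> U \<notin> x}"

lemma openin_prime_open [simp]: "openin S (prime_open S x)"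
  by (auto simp: prime_open_def)

text \<open>Complete primeness keeps the union of all open sets outside \<open>x\<close> outside
  \<open>x\<close>. The complement of \<open>x\<close> is thus a principal down-set, and membership
  in \<open>x\<close> becomes a question of inclusion.\<close>

lemma notin_cpf_iff:
  assumes x: "completely_prime_filter (opens S) x" and "openin S U"
  shows "U \<notin> x \<longleftrightarrow> U \<subseteq> prime_open S x"
proof
  have "prime_open S x \<notin> x"
    using cpf_Union[OF x, of "{U. openin S U \<and> U \<notin> x}"] by (auto simp: prime_open_def)
  then show "U \<subseteq> prime_open S x \<Longrightarrow> U \<notin> x"
    using cpf_mono[OF x] by auto
qed (use assms in \<open>auto simp: prime_open_def\<close>)

lemma prime_open_notin:
  "completely_prime_filter (opens S) x \<Longrightarrow> prime_open S x \<notin> x"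
  by (simp add: notin_cpf_iff)

section \<open>Open sets, closed sets and point closures of the soberification\<close>

lemma openin_soberification:
  "openin (soberification S) V \<longleftrightarrow>
    (\<exists>U. openin S U \<and> V = {x. completely_prime_filter (opens S) x \<and> U \<in> x})"
  using frame.openin_pt[OF frame_opens] by (auto simp: soberification_def)

lemma topspace_soberification:
  "topspace (soberification S) = {x. completely_prime_filter (opens S) x}"
  using frame.topspace_pt[OF frame_opens] by (auto simp: soberification_def)

lemma closedin_soberification:
  "closedin (soberification S) F \<longleftrightarrow>
    (\<exists>U. openin S U \<and> F = {x. completely_prime_filter (opens S) x \<and> U \<notin> x})"
proof
  assume "closedin (soberification S) F"
  then have F: "F \<subseteq> topspace (soberification S)"
    and "openin (soberification S) (topspace (soberification S) - F)"
    by (auto simp: closedin_def)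
  then obtain U where U: "openin S U"
      "topspace (soberification S) - F = {x. completely_prime_filter (opens S) x \<and> U \<in> x}"
    by (auto simp: openin_soberification)
  then have "F = {x. completely_prime_filter (opens S) x \<and> U \<notin> x}"
    using F by (auto simp: topspace_soberification)
  with U show "\<exists>U. openin S U \<and> F = {x. completely_prime_filter (opens S) x \<and> U \<notin> x}"
    by blast
next
  assume "\<exists>U. openin S U \<and> F = {x. completely_prime_filter (opens S) x \<and> U \<notin> x}"
  then obtain U where U: "openin S U" "F = {x. completely_prime_filter (opens S) x \<and> U \<notin> x}"
    by blast
  then have "topspace (soberification S) - F = {x. completely_prime_filter (opens S) x \<and> U \<in> x}"
    by (auto simp: topspace_soberification)
  with U show "closedin (soberification S) F"
    by (auto simp: closedin_def openin_soberification topspace_soberification)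
qed

text \<open>The basic open sets around \<open>y\<close> are indexed by the members of
  \<open>y\<close>, so all of them contain \<open>x\<close> exactly when
  \<open>y \<subseteq> x\<close>.\<close>

lemma closure_of_soberification:
  assumes "completely_prime_filter (opens S) x"
  shows "soberification S closure_of {x} = {y. completely_prime_filter (opens S) y \<and> y \<subseteq> x}"
    (is "?c = ?d")
proof
  show "?c \<subseteq> ?d"
  proof
    fix y assume y: "y \<in> ?c"
    then have y': "completely_prime_filter (opens S) y"
      by (auto simp: in_closure_of topspace_soberification)
    have "U \<in> x" if "U \<in> y" for U
    proof -
      have "openin (soberification S) {z. completely_prime_filter (opens S) z \<and> U \<in> z}"
        using cpf_open[OF y' that] by (auto simp: openin_soberification)
      moreover have "y \<in> {z. completely_prime_filter (opens S) z \<and> U \<in> z}"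
        using that y' by simp
      ultimately have "x \<in> {z. completely_prime_filter (opens S) z \<and> U \<in> z}"
        using y[unfolded in_closure_of, THEN conjunct2, rule_format,
            of "{z. completely_prime_filter (opens S) z \<and> U \<in> z}"] by simp
      then show ?thesis by simp
    qed
    with y' show "y \<in> ?d" by auto
  qed
  show "?d \<subseteq> ?c"
    using assms by (auto simp: in_closure_of topspace_soberification openin_soberification)
qed

section \<open>Nuclei on a frame of open sets\<close>

lemma le_nuclei [simp]: "(\<sqsubseteq>\<^bsub>nuclei (opens S)\<^esub>) = (\<lambda>j k. \<forall>U. openin S U \<longrightarrow> j U \<subseteq> k U)"
  by (simp add: nuclei_def)

lemma carrier_nuclei:
  "j \<in> carrier (nuclei (opens S)) \<longleftrightarrow> j \<in> extensional {U. openin S U} \<and>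
    (\<forall>U. openin S U \<longrightarrow> openin S (j U) \<and> U \<subseteq> j U \<and> j (j U) \<subseteq> j U) \<and>
    (\<forall>U V. openin S U \<longrightarrow> openin S V \<longrightarrow> j (U \<inter> V) = j U \<inter> j V)" (is "?l \<longleftrightarrow> ?r")
proof
  show "?l \<Longrightarrow> ?r"
    by (auto simp: nuclei_def PiE_def Pi_iff meet_opens)
  show "?r \<Longrightarrow> ?l"
    by (simp add: nuclei_def PiE_def Pi_iff meet_opens)
qed

text \<open>Monotonicity supplies one half of the preservation of intersections, so only the other
  half has to be checked for each concrete nucleus.\<close>

lemma restrict_nucleus:
  assumes "\<And>U. openin S U \<Longrightarrow> openin S (j U)"
    and "\<And>U. openin S U \<Longrightarrow> U \<subseteq> j U"
    and "\<And>U. openin S U \<Longrightarrow> j (j U) \<subseteq> j U"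
    and "\<And>U V. openin S U \<Longrightarrow> openin S V \<Longrightarrow> U \<subseteq> V \<Longrightarrow> j U \<subseteq> j V"
    and "\<And>U V. openin S U \<Longrightarrow> openin S V \<Longrightarrow> j U \<inter> j V \<subseteq> j (U \<inter> V)"
  shows "restrict j {U. openin S U} \<in> carrier (nuclei (opens S))"
proof -
  have "j (U \<inter> V) = j U \<inter> j V" if "openin S U" "openin S V" for U V
    using assms(4)[of "U \<inter> V" U] assms(4)[of "U \<inter> V" V] assms(5)[of U V] that by auto
  then show ?thesis
    using assms(1-3) by (simp add: carrier_nuclei openin_Int)
qed

context
  fixes S :: "'a topology" and j
  assumes j: "j \<in> carrier (nuclei (opens S))"
begin

lemma nucleus_open: "openin S U \<Longrightarrow> openin S (j U)"
  using j by (simp add: carrier_nuclei)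

lemma nucleus_upper: "openin S U \<Longrightarrow> U \<subseteq> j U"
  using j by (simp add: carrier_nuclei)

lemma nucleus_idem: "openin S U \<Longrightarrow> j (j U) = j U"
  using j by (simp add: carrier_nuclei subset_antisym)

lemma nucleus_Int: "openin S U \<Longrightarrow> openin S V \<Longrightarrow> j (U \<inter> V) = j U \<inter> j V"
  using j by (simp add: carrier_nuclei)

lemma nucleus_mono: "openin S U \<Longrightarrow> openin S V \<Longrightarrow> U \<subseteq> V \<Longrightarrow> j U \<subseteq> j V"
  using nucleus_Int[of U V] by (simp add: Int_absorb2 le_iff_inf)

end

lemma partial_order_nuclei: "partial_order (nuclei (opens S))"
proof
  show "(.=\<^bsub>nuclei (opens S)\<^esub>) = (=)"
    by (simp add: nuclei_def)
next
  fix j k assume "j \<sqsubseteq>\<^bsub>nuclei (opens S)\<^esub> k" "k \<sqsubseteq>\<^bsub>nuclei (opens S)\<^esub> j"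
    "j \<in> carrier (nuclei (opens S))" "k \<in> carrier (nuclei (opens S))"
  then have "j = k"
    by (intro extensionalityI[of j "{U. openin S U}" k]) (auto simp: carrier_nuclei)
  then show "j .=\<^bsub>nuclei (opens S)\<^esub> k"
    by (simp add: nuclei_def)
qed (auto simp: nuclei_def)

section \<open>Heyting implication of open sets; closed, open and double negation nuclei\<close>

definition himp :: "'a topology \<Rightarrow> 'a set \<Rightarrow> 'a set \<Rightarrow> 'a set" where
  "himp S U V = \<Union>{W. openin S W \<and> W \<inter> U \<subseteq> V}"

lemma openin_himp [simp]: "openin S (himp S U V)"
  by (auto simp: himp_def)

lemma himp_Int: "himp S U V \<inter> U \<subseteq> V"
  by (auto simp: himp_def)

lemma subset_himp_iff: "openin S W \<Longrightarrow> W \<subseteq> himp S U V \<longleftrightarrow> W \<inter> U \<subseteq> V"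
  using himp_Int[of S U V] by (auto simp: himp_def)

lemma closed_nucleus:
  "openin S U \<Longrightarrow> restrict (\<lambda>V. U \<union> V) {V. openin S V} \<in> carrier (nuclei (opens S))"
  by (intro restrict_nucleus) auto

text \<open>Among the nuclei this one is the complement of the closed nucleus of \<open>U\<close>.
  It later forces a point that avoids the closed nucleus of a prime open set into the open
  one.\<close>

lemma open_nucleus:
  assumes "openin S U"
  shows "restrict (himp S U) {V. openin S V} \<in> carrier (nuclei (opens S))"
proof (intro restrict_nucleus)
  fix V W assume V: "openin S V" and W: "openin S W"
  show "V \<subseteq> himp S U V"
    using V by (auto simp: subset_himp_iff)
  show "himp S U (himp S U V) \<subseteq> himp S U V"
    using himp_Int[of S U V] himp_Int[of S U "himp S U V"] by (auto simp: subset_himp_iff)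
  show "himp S U V \<inter> himp S U W \<subseteq> himp S U (V \<inter> W)"
    using himp_Int[of S U V] himp_Int[of S U W] by (auto simp: subset_himp_iff openin_Int)
  show "himp S U V \<subseteq> himp S U W" if "V \<subseteq> W"
    using that himp_Int[of S U V] by (auto simp: subset_himp_iff)
qed auto

lemma double_negation_nucleus:
  "restrict (\<lambda>U. himp S (himp S U B) B) {U. openin S U} \<in> carrier (nuclei (opens S))"
proof (intro restrict_nucleus)
  fix U V assume U: "openin S U" and V: "openin S V"
  define n where "n W = himp S W B" for W
  have n: "openin S (n W)" "n W \<inter> W \<subseteq> B" for W
    by (auto simp: n_def himp_Int)
  have nI: "Z \<subseteq> n W" if "openin S Z" "Z \<inter> W \<subseteq> B" for Z W
    using that by (simp add: n_def subset_himp_iff)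
  show "U \<subseteq> himp S (himp S U B) B"
    unfolding n_def[symmetric] using n[of U] U by (intro nI) auto
  \<comment> \<open>The map \<open>n\<close> is antitone, so applying it to this inclusion gives
    idempotence of the double negation.\<close>
  have "n U \<subseteq> n (n (n U))"
    using n[of "n U"] n[of U] by (intro nI) auto
  then show "himp S (himp S (himp S (himp S U B) B) B) B \<subseteq> himp S (himp S U B) B"
    unfolding n_def[symmetric] using n[of "n (n (n U))"] by (intro nI) auto
  show "himp S (himp S U B) B \<subseteq> himp S (himp S V B) B" if "U \<subseteq> V"
  proof -
    have "n V \<subseteq> n U" using n[of V] that by (intro nI) auto
    then show ?thesis
      unfolding n_def[symmetric] using n[of "n U"] by (intro nI) auto
  qed
  show "himp S (himp S U B) B \<inter> himp S (himp S V B) B \<subseteq> himp S (himp S (U \<inter> V) B) B"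
  proof -
    \<comment> \<open>Negate one factor at a time: \<open>Z \<inter> U\<close> is disjoint from
      \<open>V\<close> modulo \<open>B\<close>, hence \<open>n (n V) \<inter> Z\<close> is disjoint
      from \<open>U\<close>, hence \<open>n (n U) \<inter> n (n V)\<close> is disjoint from
      \<open>Z\<close>.\<close>
    define Z where "Z = n (U \<inter> V)"
    have Z: "openin S Z" "Z \<inter> (U \<inter> V) \<subseteq> B" using n by (auto simp: Z_def)
    have "Z \<inter> U \<subseteq> n V"
      using Z U by (intro nI) auto
    then have "n (n V) \<inter> Z \<subseteq> n U"
      using n[of "n V"] Z by (intro nI) auto
    then have "n (n U) \<inter> n (n V) \<subseteq> n Z"
      using n[of "n U"] n[of "n V"] by (intro nI) auto
    then show ?thesis
      by (simp add: Z_def n_def)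
  qed
qed auto

section \<open>Spatiality from weak scatteredness\<close>

text \<open>An order isomorphism transports joins, meets and hence the distributive law from
  \<open>opens X\<close>. This yields the frame half of \<open>spatial\<close> for the nuclei
  without a formula for their joins.\<close>

lemma frame_iso_opens_imp_frame:
  fixes L :: "'a gorder" (structure) and X :: "'b topology"
  assumes "partial_order L" and iso: "frame_iso L (opens X) f"
  shows "frame L"
proof -
  interpret partial_order L by fact
  have emb: "a \<sqsubseteq> b \<longleftrightarrow> f a \<subseteq> f b" if "a \<in> carrier L" "b \<in> carrier L" for a b
    using iso that by (auto simp: frame_iso_def order_emb_def)
  have im: "f ` carrier L = {U. openin X U}"
    using iso by (simp add: frame_iso_def bij_betw_def)
  then have op: "openin X (f a)" if "a \<in> carrier L" for a
    using that by blast
  have surj: "\<exists>a\<in>carrier L. f a = U" if "openin X U" for U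
  proof -
    have "U \<in> f ` carrier L" using im that by simp
    then show ?thesis by blast
  qed
  have op_Union: "openin X (\<Union>(f ` A))" if "A \<subseteq> carrier L" for A
    using that op by (intro openin_Union) auto
  have least: "least L a (Upper L A)"
    if "A \<subseteq> carrier L" "a \<in> carrier L" "f a = \<Union>(f ` A)" for a A
  proof (intro least_UpperI)
    fix b assume "b \<in> A"
    then show "b \<sqsubseteq> a" using that by (subst emb) auto
  next
    fix b assume "b \<in> Upper L A"
    then have "b \<in> carrier L" "\<And>c. c \<in> A \<Longrightarrow> f c \<subseteq> f b"
      using that(1) emb unfolding Upper_def by blast+
    then show "a \<sqsubseteq> b" using that by (subst emb) auto
  qed (use that in auto)
  have greatest: "greatest L a (Lower L A)"
    if "A \<subseteq> carrier L" "a \<in> carrier L" "f a = X interior_of (topspace X \<inter> \<Inter>(f ` A))" for a A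
  proof (intro greatest_LowerI)
    fix b assume b: "b \<in> A"
    then show "a \<sqsubseteq> b"
      using that interior_of_subset[of X "topspace X \<inter> \<Inter>(f ` A)"] by (subst emb) auto
  next
    fix b assume "b \<in> Lower L A"
    then have b: "b \<in> carrier L" "\<And>c. c \<in> A \<Longrightarrow> f b \<subseteq> f c"
      using that(1) emb unfolding Lower_def by blast+
    then show "b \<sqsubseteq> a"
      using that op[OF b(1)] openin_subset[OF op[OF b(1)]]
      by (simp add: emb interior_of_maximal le_INF_iff)
  qed (use that in auto)
  interpret complete_lattice L
  proof (rule complete_latticeI)
    fix A assume A: "A \<subseteq> carrier L"
    show "\<exists>s. least L s (Upper L A)"
      using least[OF A] surj[OF op_Union[OF A]] by metis
    show "\<exists>i. greatest L i (Lower L A)"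
      using greatest[OF A] surj[OF openin_interior_of] by metis
  qed
  have f_sup: "f (\<Squnion>A) = \<Union>(f ` A)" if A: "A \<subseteq> carrier L" for A
  proof -
    obtain a where a: "a \<in> carrier L" "f a = \<Union>(f ` A)"
      using surj[OF op_Union[OF A]] by blast
    then have "\<Squnion>A = a"
      using least_unique[OF sup_lub[OF A] least[OF A]] by simp
    with a show ?thesis by simp
  qed
  have f_meet: "f (a \<sqinter> b) = f a \<inter> f b" if ab: "a \<in> carrier L" "b \<in> carrier L" for a b
  proof -
    obtain c where c: "c \<in> carrier L" "f c = f a \<inter> f b"
      using surj[OF openin_Int[OF op[OF ab(1)] op[OF ab(2)]]] by blast
    have "f c \<subseteq> f (a \<sqinter> b)"
      using meet_le[of c a b] c ab emb by auto
    moreover have "f (a \<sqinter> b) \<subseteq> f a" "f (a \<sqinter> b) \<subseteq> f b"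
      using ab meet_left[of a b] meet_right[of a b] emb by simp_all
    ultimately show ?thesis using c by auto
  qed
  show ?thesis
  proof
    fix a A assume a: "a \<in> carrier L" and A: "A \<subseteq> carrier L"
    have A': "(\<lambda>s. a \<sqinter> s) ` A \<subseteq> carrier L"
      using a A by auto
    have "f (a \<sqinter> \<Squnion>A) = f (\<Squnion>((\<lambda>s. a \<sqinter> s) ` A))"
      using a A A' by (auto simp: f_meet f_sup subset_iff)
    then show "a \<sqinter> \<Squnion>A = \<Squnion>((\<lambda>s. a \<sqinter> s) ` A)"
      using a A A' emb by (intro le_antisym) auto
  qed
qed

text \<open>The Skula topology of the soberification: \<open>y\<close> lies in the closure of \<open>x\<close> iff \<open>y \<subseteq> x\<close>.\<close>

definition skula_pt :: "'a topology \<Rightarrow> 'a set set topology" where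
  "skula_pt S = topology (\<lambda>G. \<forall>x\<in>G. completely_prime_filter (opens S) x \<and>
     (\<exists>U\<in>x. \<forall>y. completely_prime_filter (opens S) y \<and> U \<in> y \<and> y \<subseteq> x \<longrightarrow> y \<in> G))"

text \<open>The neighbourhoods of \<open>x\<close> are traces of basic open sets on the closure of
  \<open>x\<close>. Those for \<open>U\<close> and \<open>V\<close> both contain the one for
  \<open>U \<inter> V\<close>, so the condition defines a topology.\<close>

lemma openin_skula_pt:
  "openin (skula_pt S) G \<longleftrightarrow> (\<forall>x\<in>G. completely_prime_filter (opens S) x \<and>
     (\<exists>U\<in>x. \<forall>y. completely_prime_filter (opens S) y \<and> U \<in> y \<and> y \<subseteq> x \<longrightarrow> y \<in> G))"
proof -
  have "istopology (\<lambda>G. \<forall>x\<in>G. completely_prime_filter (opens S) x \<and>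
     (\<exists>U\<in>x. \<forall>y. completely_prime_filter (opens S) y \<and> U \<in> y \<and> y \<subseteq> x \<longrightarrow> y \<in> G))"
    (is "istopology ?P")
    unfolding istopology_def
  proof (intro conjI allI impI)
    fix G H assume GH: "?P G" "?P H"
    show "?P (G \<inter> H)"
    proof
      fix x assume x: "x \<in> G \<inter> H"
      then have c: "completely_prime_filter (opens S) x" using GH by blast
      obtain U V where U: "U \<in> x"
          "\<And>y. completely_prime_filter (opens S) y \<Longrightarrow> U \<in> y \<Longrightarrow> y \<subseteq> x \<Longrightarrow> y \<in> G"
        and V: "V \<in> x"
          "\<And>y. completely_prime_filter (opens S) y \<Longrightarrow> V \<in> y \<Longrightarrow> y \<subseteq> x \<Longrightarrow> y \<in> H"
        using GH[THEN bspec, of x] x by auto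
      have op: "openin S U" "openin S V" using U V cpf_open[OF c] by auto
      then show "completely_prime_filter (opens S) x \<and>
         (\<exists>U\<in>x. \<forall>y. completely_prime_filter (opens S) y \<and> U \<in> y \<and> y \<subseteq> x \<longrightarrow> y \<in> G \<inter> H)"
        using c U V by (intro conjI bexI[of _ "U \<inter> V"]) (auto simp: cpf_Int)
    qed
  next
    fix \<K> assume K: "\<forall>K\<in>\<K>. ?P K"
    show "?P (\<Union>\<K>)"
    proof
      fix x assume "x \<in> \<Union>\<K>"
      then obtain G where G: "G \<in> \<K>" "x \<in> G" by blast
      from K[rule_format, OF this]
      show "completely_prime_filter (opens S) x \<and>
         (\<exists>U\<in>x. \<forall>y. completely_prime_filter (opens S) y \<and> U \<in> y \<and> y \<subseteq> x \<longrightarrow> y \<in> \<Union>\<K>)"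
        using G(1) by (meson UnionI)
    qed
  qed
  then show ?thesis
    by (simp add: skula_pt_def topology_inverse')
qed

text \<open>For a nucleus \<open>j\<close> the points left out are exactly those whose prime open
  set is fixed by \<open>j\<close>.\<close>

definition nucleus_points :: "'a topology \<Rightarrow> ('a set \<Rightarrow> 'a set) \<Rightarrow> 'a set set set" where
  "nucleus_points S j = {x. completely_prime_filter (opens S) x \<and> j (prime_open S x) \<in> x}"

text \<open>The Skula neighbourhood of \<open>x\<close> is given by
  \<open>j (prime_open S x)\<close> itself: shrinking \<open>x\<close> to \<open>y\<close> enlarges
  the prime open set, and \<open>j\<close> is monotone.\<close>

lemma openin_nucleus_points:
  assumes j: "j \<in> carrier (nuclei (opens S))"
  shows "openin (skula_pt S) (nucleus_points S j)"
  unfolding openin_skula_pt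
proof
  fix x assume "x \<in> nucleus_points S j"
  then have x: "completely_prime_filter (opens S) x" "j (prime_open S x) \<in> x"
    by (auto simp: nucleus_points_def)
  have "y \<in> nucleus_points S j"
    if y: "completely_prime_filter (opens S) y" "j (prime_open S x) \<in> y" "y \<subseteq> x" for y
  proof -
    have "prime_open S x \<subseteq> prime_open S y"
      using y(3) by (auto simp: prime_open_def)
    then have "j (prime_open S x) \<subseteq> j (prime_open S y)"
      by (intro nucleus_mono[OF j]) auto
    then show ?thesis
      using y cpf_mono[OF y(1,2)] nucleus_open[OF j openin_prime_open]
      by (simp add: nucleus_points_def)
  qed
  with x show "completely_prime_filter (opens S) x \<and>
     (\<exists>U\<in>x. \<forall>y. completely_prime_filter (opens S) y \<and> U \<in> y \<and> y \<subseteq> x \<longrightarrow> y \<in> nucleus_points S j)"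
    by blast
qed

lemma nucleus_points_surj:
  assumes G: "openin (skula_pt S) G"
  shows "\<exists>j\<in>carrier (nuclei (opens S)). nucleus_points S j = G"
proof -
  \<comment> \<open>The nucleus will send \<open>U\<close> to the largest open \<open>V\<close> with
    \<open>Q U V\<close>. Complete primeness passes \<open>Q U\<close> on to the union
    \<open>i U\<close>, which is the content of \<open>iD\<close>.\<close>
  define Q where "Q U V \<longleftrightarrow> openin S V \<and>
    (\<forall>y. completely_prime_filter (opens S) y \<and> V \<in> y \<and> U \<notin> y \<longrightarrow> y \<in> G)" for U V
  define i where "i U = \<Union>{V. Q U V}" for U
  have op: "openin S (i U)" for U
    by (auto simp: i_def Q_def)
  have iI: "V \<subseteq> i U" if "Q U V" for U V
    using that by (auto simp: i_def)
  have iD: "y \<in> G" if y: "completely_prime_filter (opens S) y" "i U \<in> y" "U \<notin> y" for U y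
    using cpf_Union[OF y(1), of "{V. Q U V}"] y by (auto simp: i_def Q_def)
  have nuc: "restrict i {U. openin S U} \<in> carrier (nuclei (opens S))"
  proof (intro restrict_nucleus)
    fix U V assume U: "openin S U" and V: "openin S V"
    show "U \<subseteq> i U" using U by (intro iI) (auto simp: Q_def)
    \<comment> \<open>A point containing \<open>i (i U)\<close> but not \<open>U\<close> lies in
      \<open>G\<close> in either case: use \<open>iD\<close> for \<open>U\<close> if it contains
      \<open>i U\<close>, and for \<open>i U\<close> otherwise.\<close>
    show "i (i U) \<subseteq> i U"
      using op iD by (intro iI) (metis Q_def)
    show "i U \<subseteq> i V" if "U \<subseteq> V"
      using op iD cpf_mono[OF _ _ V that] by (intro iI) (metis Q_def)
    show "i U \<inter> i V \<subseteq> i (U \<inter> V)"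
      using op iD U V by (intro iI) (auto simp: Q_def cpf_Int)
  qed (rule op)
  moreover have "nucleus_points S (restrict i {U. openin S U}) = G"
  proof (intro subset_antisym subsetI)
    fix x assume "x \<in> nucleus_points S (restrict i {U. openin S U})"
    then show "x \<in> G"
      using iD[of x "prime_open S x"] prime_open_notin by (auto simp: nucleus_points_def)
  next
    fix x assume "x \<in> G"
    then have x: "completely_prime_filter (opens S) x"
      and "\<exists>U\<in>x. \<forall>y. completely_prime_filter (opens S) y \<and> U \<in> y \<and> y \<subseteq> x \<longrightarrow> y \<in> G"
      using G by (auto simp: openin_skula_pt)
    then obtain W where W: "W \<in> x"
      and WG: "\<And>y. completely_prime_filter (opens S) y \<Longrightarrow> W \<in> y \<Longrightarrow> y \<subseteq> x \<Longrightarrow> y \<in> G"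
      by blast
    \<comment> \<open>A point omitting the prime open set of \<open>x\<close> is contained in
      \<open>x\<close>, so this is Skula openness of \<open>G\<close> at \<open>x\<close>.\<close>
    have "Q (prime_open S x) W"
      unfolding Q_def
    proof (intro conjI allI impI)
      show "openin S W" using cpf_open[OF x W] .
      fix y assume y: "completely_prime_filter (opens S) y \<and> W \<in> y \<and> prime_open S x \<notin> y"
      have "y \<subseteq> x"
      proof (rule ccontr)
        assume "\<not> y \<subseteq> x"
        then obtain U where U: "U \<in> y" "U \<notin> x" by blast
        then have "openin S U" using y cpf_open by blast
        with U have "U \<subseteq> prime_open S x"
          using notin_cpf_iff x by blast
        with U y show False using cpf_mono[of S y U "prime_open S x"] by auto
      qed
      with y WG show "y \<in> G" by blast
    qed
    then have "W \<subseteq> i (prime_open S x)" by (rule iI)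
    then show "x \<in> nucleus_points S (restrict i {U. openin S U})"
      using x W cpf_mono[OF x W op] by (simp add: nucleus_points_def)
  qed
  ultimately show ?thesis by blast
qed

lemma nucleus_points_reflects_order:
  assumes ws: "weakly_scattered (soberification S)"
    and j: "j \<in> carrier (nuclei (opens S))" and k: "k \<in> carrier (nuclei (opens S))"
    and sub: "nucleus_points S j \<subseteq> nucleus_points S k" and U: "openin S U"
  shows "j U \<subseteq> k U"
proof (rule ccontr)
  assume "\<not> j U \<subseteq> k U"
  then obtain s where s: "s \<in> j U" "s \<notin> k U" by blast
  have op: "openin S (j U)" "openin S (k U)"
    using U nucleus_open[OF j] nucleus_open[OF k] by auto
  \<comment> \<open>Since \<open>s\<close> is outside \<open>V\<close>, its neighbourhood filter
    lies in the closed set \<open>C\<close> of points omitting \<open>V\<close>, which is therefore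
    nonempty.\<close>
  define V where "V = himp S (j U) (k U)"
  define C where "C = {x. completely_prime_filter (opens S) x \<and> V \<notin> x}"
  have V: "openin S V" "V \<inter> j U \<subseteq> k U"
    using himp_Int[of S "j U" "k U"] by (auto simp: V_def)
  have VI: "W \<subseteq> V" if "openin S W" "W \<inter> j U \<subseteq> k U" for W
    using that by (simp add: V_def subset_himp_iff)
  have nbhd: "{W. openin S W \<and> t \<in> W} \<in> C" if "t \<in> topspace S" "t \<notin> V" for t
    using that cpf_neighbourhoods by (auto simp: C_def)
  have "s \<in> topspace S" "s \<notin> V"
    using s V openin_subset[OF op(1)] by auto
  then have "C \<noteq> {}" using nbhd by blast
  moreover have "closedin (soberification S) C"
    using V by (auto simp: closedin_soberification C_def)
  ultimately obtain x where "weakly_isolated_in (soberification S) C x"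
    using ws by (auto simp: weakly_scattered_def)
  then obtain W where xC: "x \<in> C" and W: "openin S W" "W \<in> x"
    and iso: "\<And>y. y \<in> C \<Longrightarrow> completely_prime_filter (opens S) y \<Longrightarrow> W \<in> y
      \<Longrightarrow> y \<in> soberification S closure_of {x}"
    unfolding weakly_isolated_in_def openin_soberification by blast
  have x: "completely_prime_filter (opens S) x" "V \<notin> x"
    using xC by (auto simp: C_def)
  define P where "P = prime_open S x"
  have P: "openin S P" "P \<notin> x"
    using prime_open_notin[OF x(1)] by (auto simp: P_def)
  \<comment> \<open>Weak isolation read in \<open>S\<close>: the neighbourhood filter of a point of
    \<open>W\<close> outside \<open>V\<close> is contained in \<open>x\<close>, so that point cannot
    lie in \<open>P\<close>.\<close>
  have WP: "W \<inter> P \<subseteq> V"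
  proof (rule ccontr)
    assume "\<not> W \<inter> P \<subseteq> V"
    then obtain t where t: "t \<in> W" "t \<in> P" "t \<notin> V" by blast
    then have ts: "t \<in> topspace S" using W openin_subset by blast
    have "{W. openin S W \<and> t \<in> W} \<in> soberification S closure_of {x}"
      using iso[OF nbhd[OF ts t(3)] cpf_neighbourhoods[OF ts]] W t by blast
    then show False
      using t P by (auto simp: closure_of_soberification[OF x(1)])
  qed
  have "k U \<subseteq> V" using op by (intro VI) auto
  then have kU: "k U \<notin> x"
    using x cpf_mono V by blast
  then have "U \<notin> x"
    using cpf_mono[OF x(1) _ op(2)] nucleus_upper[OF k U] by blast
  then have "U \<subseteq> P"
    using notin_cpf_iff[OF x(1) U] by (simp add: P_def)
  then have jP: "j U \<subseteq> j P"
    using nucleus_mono[OF j U P(1)] by blast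
  \<comment> \<open>Otherwise \<open>j U \<subseteq> P\<close>, so \<open>W \<inter> j U\<close>
    lies in \<open>V \<inter> j U\<close> and hence in \<open>k U\<close>. Then
    \<open>W \<subseteq> V\<close>, although \<open>W\<close> is in \<open>x\<close> and
    \<open>V\<close> is not.\<close>
  have jU: "j U \<in> x"
  proof (rule ccontr)
    assume "j U \<notin> x"
    then have "j U \<subseteq> P"
      using notin_cpf_iff[OF x(1) op(1)] by (simp add: P_def)
    then have "W \<subseteq> V"
      using WP V W by (intro VI) auto
    then show False
      using W x cpf_mono V by blast
  qed
  then have "x \<in> nucleus_points S j"
    using jP x cpf_mono[OF x(1)] nucleus_open[OF j P(1)] by (auto simp: nucleus_points_def P_def)
  then have kP: "k P \<in> x"
    using sub by (auto simp: nucleus_points_def P_def)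
  \<comment> \<open>Applying \<open>k\<close> replaces \<open>P\<close> by \<open>k P\<close>. Then
    every factor on the left is in \<open>x\<close>, while \<open>k U\<close> is not.\<close>
  have "(W \<inter> j U) \<inter> P \<subseteq> k U"
    using WP V by blast
  then have "k ((W \<inter> j U) \<inter> P) \<subseteq> k (k U)"
    using W op P by (intro nucleus_mono[OF k]) auto
  then have "k (W \<inter> j U) \<inter> k P \<subseteq> k U"
    using W op P U by (simp add: nucleus_Int[OF k] nucleus_idem[OF k] openin_Int)
  then have "(W \<inter> j U) \<inter> k P \<subseteq> k U"
    using nucleus_upper[OF k, of "W \<inter> j U"] W op by auto
  moreover have "(W \<inter> j U) \<inter> k P \<in> x"
    using W op P jU kP x(1) nucleus_open[OF k P(1)] by (simp add: cpf_Int openin_Int)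
  ultimately show False
    using kU cpf_mono[OF x(1) _ op(2)] by blast
qed

lemma weakly_scattered_imp_spatial:
  assumes "weakly_scattered (soberification S)"
  shows "spatial (nuclei (opens S))"
proof -
  have emb: "j \<sqsubseteq>\<^bsub>nuclei (opens S)\<^esub> k \<longleftrightarrow> nucleus_points S j \<subseteq> nucleus_points S k"
    if j: "j \<in> carrier (nuclei (opens S))" and k: "k \<in> carrier (nuclei (opens S))" for j k
  proof
    assume "j \<sqsubseteq>\<^bsub>nuclei (opens S)\<^esub> k"
    then have "j (prime_open S x) \<subseteq> k (prime_open S x)" for x
      by simp
    then show "nucleus_points S j \<subseteq> nucleus_points S k"
      using cpf_mono[OF _ _ nucleus_open[OF k openin_prime_open]]
      unfolding nucleus_points_def by blast
  qed (use nucleus_points_reflects_order[OF assms j k] in simp)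
  interpret N: partial_order "nuclei (opens S)" by (rule partial_order_nuclei)
  have "inj_on (nucleus_points S) (carrier (nuclei (opens S)))"
    by (intro inj_onI N.le_antisym) (simp_all add: emb del: le_nuclei)
  moreover have "nucleus_points S ` carrier (nuclei (opens S)) = {G. openin (skula_pt S) G}"
    using openin_nucleus_points nucleus_points_surj by blast
  ultimately have iso: "frame_iso (nuclei (opens S)) (opens (skula_pt S)) (nucleus_points S)"
    using emb N.weak_partial_order_axioms opens.weak_partial_order_axioms
    by (auto simp: frame_iso_def order_emb_def bij_betw_def simp del: le_nuclei)
  show ?thesis
    by (rule spatialI[OF frame_iso_opens_imp_frame[OF partial_order_nuclei iso] iso])
qed

section \<open>Weak scatteredness from spatiality\<close>

lemma spatial_nuclei_point:
  assumes spatial: "spatial (nuclei (opens S))"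
    and j: "j \<in> carrier (nuclei (opens S))" and j0: "j {} \<noteq> topspace S"
  shows "\<exists>x. completely_prime_filter (opens S) x \<and> j (prime_open S x) = prime_open S x"
proof -
  let ?N = "nuclei (opens S)"
  obtain X :: "('a set \<Rightarrow> 'a set) set topology" and f where iso: "frame_iso ?N (opens X) f"
    using spatial unfolding spatial_def by blast
  have emb: "f h \<subseteq> f k \<longleftrightarrow> (\<forall>U. openin S U \<longrightarrow> h U \<subseteq> k U)"
    if "h \<in> carrier ?N" "k \<in> carrier ?N" for h k
    using iso that by (auto simp: frame_iso_def order_emb_def)
  have im: "f ` carrier ?N = {U. openin X U}"
    using iso by (simp add: frame_iso_def bij_betw_def)
  then have op: "openin X (f k)" if "k \<in> carrier ?N" for k
    using that by blast
  have surj: "\<exists>k\<in>carrier ?N. f k = G" if "openin X G" for G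
  proof -
    have "G \<in> f ` carrier ?N" using im that by simp
    then show ?thesis by blast
  qed
  \<comment> \<open>By monotonicity such a \<open>k\<close> is the greatest nucleus.\<close>
  have top: "f k = topspace X" if k: "k \<in> carrier ?N" "topspace S \<subseteq> k {}" for k
  proof -
    obtain h where h: "h \<in> carrier ?N" "f h = topspace X"
      using surj[of "topspace X"] by auto
    have "h U \<subseteq> k U" if "openin S U" for U
      using nucleus_open[OF h(1) that] openin_subset[of S "h U"] k(2)
        nucleus_mono[OF k(1), of "{}" U] that by auto
    then show ?thesis
      using emb[OF h(1) k(1)] h(2) op[OF k(1)] openin_subset[of X "f k"] by auto
  qed
  define c where "c U = restrict (\<lambda>V. U \<union> V) {V. openin S V}" for U
  have c: "c U \<in> carrier ?N" if "openin S U" for U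
    using closed_nucleus[OF that] by (simp add: c_def)
  have c_eq: "c U V = U \<union> V" if "openin S V" for U V
    using that by (simp add: c_def)
  \<comment> \<open>With \<open>c_ge\<close> this makes \<open>c\<close> left adjoint to evaluation
    at \<open>{}\<close>; hence \<open>c\<close> preserves joins, which gives complete primeness of
    \<open>x\<close> below.\<close>
  have c_le: "f (c U) \<subseteq> f k" if "openin S U" "k \<in> carrier ?N" "U \<subseteq> k {}" for U k
  proof -
    have "U \<union> V \<subseteq> k V" if "openin S V" for V
      using nucleus_mono[OF \<open>k \<in> carrier ?N\<close>, of "{}" V] that \<open>U \<subseteq> k {}\<close>
        nucleus_upper[OF \<open>k \<in> carrier ?N\<close> that] by auto
    then show ?thesis
      using that by (simp add: emb c c_eq)
  qed
  have c_ge: "U \<subseteq> k {}" if "openin S U" "k \<in> carrier ?N" "f (c U) \<subseteq> f k" for U k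
  proof -
    have "c U {} \<subseteq> k {}" using that emb[OF c[OF that(1)] that(2)] by simp
    then show ?thesis by (simp add: c_eq)
  qed
  obtain s where s: "s \<in> topspace X" "s \<notin> f j"
  proof -
    have "f j \<noteq> topspace X"
    proof
      assume "f j = topspace X"
      then have "f (c (topspace S)) \<subseteq> f j"
        using openin_subset[OF op[OF c]] by simp
      then have "topspace S \<subseteq> j {}" using c_ge[OF _ j] by simp
      then show False
        using j0 nucleus_open[OF j, of "{}"] openin_subset[of S "j {}"] by auto
    qed
    then show ?thesis using that openin_subset[OF op[OF j]] by blast
  qed
  define x where "x = {U. openin S U \<and> s \<in> f (c U)}"
  have x: "completely_prime_filter (opens S) x"
    unfolding completely_prime_filter_opens
  proof (intro conjI allI impI)
    show "x \<subseteq> {U. openin S U}" by (auto simp: x_def)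
    show "topspace S \<in> x"
      using s top[of "c (topspace S)"] c by (simp add: x_def c_eq)
  next
    fix U V assume UV: "openin S U" "openin S V"
    have sub: "f (c (U \<inter> V)) \<subseteq> f (c U)" "f (c (U \<inter> V)) \<subseteq> f (c V)"
      using UV by (intro c_le c openin_Int; auto simp: c_eq)+
    have "f (c U) \<inter> f (c V) \<subseteq> f (c (U \<inter> V))"
    proof -
      \<comment> \<open>The meet of the two closed nuclei, obtained through the isomorphism. It lies
        below \<open>c (U \<inter> V)\<close> because union distributes over intersection.\<close>
      obtain m where m: "m \<in> carrier ?N" "f m = f (c U) \<inter> f (c V)"
          using surj[OF openin_Int[OF op[OF c[OF UV(1)]] op[OF c[OF UV(2)]]]] by blast
      then have "f m \<subseteq> f (c U)" "f m \<subseteq> f (c V)" by auto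
      then have "m W \<subseteq> c U W" "m W \<subseteq> c V W" if "openin S W" for W
        using emb[OF m(1) c[OF UV(1)]] emb[OF m(1) c[OF UV(2)]] that by simp_all
      then have "m W \<subseteq> c (U \<inter> V) W" if "openin S W" for W
        using that by (fastforce simp: c_eq)
      then have "f m \<subseteq> f (c (U \<inter> V))"
        using emb[OF m(1) c] UV by (simp add: openin_Int)
      with m show ?thesis by simp
    qed
    with sub UV show "U \<inter> V \<in> x \<longleftrightarrow> U \<in> x \<and> V \<in> x"
      by (auto simp: x_def)
  next
    fix A assume A: "A \<subseteq> {U. openin S U}" "\<Union>A \<in> x"
    have "openin X (\<Union>((f \<circ> c) ` A))"
      using A op c by (auto intro!: openin_Union)
    then obtain m where m: "m \<in> carrier ?N" "f m = \<Union>((f \<circ> c) ` A)"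
      using surj by blast
    have "\<Union>A \<subseteq> m {}"
    proof (rule Union_least)
      fix U assume "U \<in> A"
      then show "U \<subseteq> m {}"
        using A m by (intro c_ge) auto
    qed
    then have "f (c (\<Union>A)) \<subseteq> f m"
      using A m by (intro c_le) auto
    then show "A \<inter> x \<noteq> {}"
      using A m by (auto simp: x_def)
  qed
  define P where "P = prime_open S x"
  have P: "openin S P" "P \<notin> x"
    using prime_open_notin[OF x] by (auto simp: P_def)
  define u where "u = restrict (himp S P) {V. openin S V}"
  have u: "u \<in> carrier ?N" "\<And>V. openin S V \<Longrightarrow> u V = himp S P V"
    using open_nucleus[OF P(1)] by (auto simp: u_def)
  \<comment> \<open>The closed and open nuclei of \<open>P\<close> join to the top, and \<open>s\<close> avoids the closed one.\<close>
  have su: "s \<in> f u"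
  proof -
    obtain m where m: "m \<in> carrier ?N" "f m = f (c P) \<union> f u"
      using surj[OF openin_Un[OF op[OF c[OF P(1)]] op[OF u(1)]]] by blast
    have "P \<subseteq> m {}"
      using c_ge[OF P(1) m(1)] m by simp
    then have "m P \<subseteq> m (m {})"
      using P nucleus_open[OF m(1), of "{}"] by (intro nucleus_mono[OF m(1)]) auto
    moreover have "topspace S \<subseteq> u P"
      using P by (simp add: u subset_himp_iff)
    moreover have "u P \<subseteq> m P"
      using emb[OF u(1) m(1)] m P by auto
    ultimately have "topspace S \<subseteq> m {}"
      using nucleus_idem[OF m(1), of "{}"] by auto
    then have "s \<in> f (c P) \<union> f u"
      using top[OF m(1)] m s by simp
    then show ?thesis
      using P by (auto simp: x_def)
  qed
  have jP: "openin S (j P)" using nucleus_open[OF j P(1)] .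
  \<comment> \<open>If \<open>j P\<close> were in \<open>x\<close>, then \<open>s\<close> would lie
    in both \<open>f (c (j P))\<close> and \<open>f u\<close>. The meet of these nuclei is below
    \<open>j\<close>, as \<open>j P \<inter> j (himp S P V) = j (P \<inter> himp S P V) \<subseteq>
    j V\<close>, which contradicts \<open>s \<notin> f j\<close>.\<close>
  have "j P \<notin> x"
  proof
    assume "j P \<in> x"
    then have sc: "s \<in> f (c (j P))" by (simp add: x_def)
    obtain m where m: "m \<in> carrier ?N" "f m = f (c (j P)) \<inter> f u"
      using surj[OF openin_Int[OF op[OF c[OF jP]] op[OF u(1)]]] by blast
    have "m V \<subseteq> j V" if V: "openin S V" for V
    proof -
      have "m V \<subseteq> c (j P) V" "m V \<subseteq> u V"
        using emb[OF m(1) c[OF jP]] emb[OF m(1) u(1)] m V by auto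
      then have "m V \<subseteq> (j P \<union> V) \<inter> himp S P V"
        using V by (simp add: c_eq u)
      moreover have "j P \<inter> j (himp S P V) \<subseteq> j V"
      proof -
        have "j (P \<inter> himp S P V) \<subseteq> j V"
          using P V himp_Int[of S P V] by (intro nucleus_mono[OF j]) auto
        then show ?thesis
          using nucleus_Int[OF j P(1)] by simp
      qed
      ultimately show ?thesis
        using nucleus_upper[OF j openin_himp[of S P V]] nucleus_upper[OF j V] by blast
    qed
    then have "f m \<subseteq> f j" using emb m j by blast
    with s sc su m show False by auto
  qed
  then have "j P \<subseteq> P"
    using notin_cpf_iff[OF x jP] by (simp add: P_def)
  then have "j P = P" using nucleus_upper[OF j P(1)] by blast
  with x show ?thesis by (auto simp: P_def)
qed

lemma spatial_imp_weakly_scattered: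
  assumes "spatial (nuclei (opens S))"
  shows "weakly_scattered (soberification S)"
  unfolding weakly_scattered_def
proof (intro allI impI, elim conjE)
  fix F assume "closedin (soberification S) F" and ne: "F \<noteq> {}"
  then obtain B where B: "openin S B"
      and F: "F = {x. completely_prime_filter (opens S) x \<and> B \<notin> x}"
    by (auto simp: closedin_soberification)
  define j where "j = restrict (\<lambda>U. himp S (himp S U B) B) {U. openin S U}"
  have j: "j \<in> carrier (nuclei (opens S))"
    unfolding j_def by (rule double_negation_nucleus)
  have "B \<noteq> topspace S"
    using ne cpf_topspace by (auto simp: F)
  moreover have "j {} \<subseteq> B"
  proof -
    have "topspace S \<subseteq> himp S {} B"
      by (simp add: subset_himp_iff)
    then show ?thesis
      using himp_Int[of S "himp S {} B" B] openin_subset[OF openin_himp[of S "himp S {} B" B]]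
      by (auto simp: j_def)
  qed
  ultimately have "j {} \<noteq> topspace S"
    using openin_subset[OF B] by blast
  then obtain x where x: "completely_prime_filter (opens S) x"
      and fix_P: "j (prime_open S x) = prime_open S x"
    using spatial_nuclei_point[OF assms j] by blast
  define P where "P = prime_open S x"
  have P: "openin S P" "P \<notin> x" and jP: "himp S (himp S P B) B = P"
    using prime_open_notin[OF x] fix_P by (auto simp: P_def j_def)
  \<comment> \<open>The open set that will isolate \<open>x\<close> in \<open>F\<close>. As
    \<open>P\<close> is fixed by the double negation, \<open>himp S V B = P\<close>.\<close>
  define V where "V = himp S P B"
  have V: "openin S V" "V \<inter> P \<subseteq> B"
    by (auto simp: V_def himp_Int)
  have "B \<subseteq> P"
    using B jP subset_himp_iff[OF B, of "himp S P B" B] by blast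
  then have xF: "x \<in> F"
    using notin_cpf_iff[OF x B] x by (simp add: F P_def)
  \<comment> \<open>Otherwise \<open>V \<subseteq> P\<close> gives \<open>V \<subseteq> B\<close>,
    so \<open>himp S V B\<close>, which is \<open>P\<close>, is the whole space.\<close>
  have "V \<in> x"
  proof (rule ccontr)
    assume "V \<notin> x"
    then have "V \<subseteq> P" using notin_cpf_iff[OF x V(1)] by (simp add: P_def)
    then have "V \<subseteq> B" using V by blast
    then have "topspace S \<subseteq> himp S V B" by (auto simp: subset_himp_iff)
    then have "topspace S \<subseteq> P" using jP by (simp add: V_def)
    then show False using P cpf_topspace[OF x] cpf_mono[OF x] by blast
  qed
  \<comment> \<open>A member of \<open>y\<close> outside \<open>x\<close> lies in \<open>P\<close>,
    which puts \<open>V \<inter> P\<close> and then \<open>B\<close> into \<open>y\<close>.\<close>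
  moreover have "y \<subseteq> x" if y: "completely_prime_filter (opens S) y" "B \<notin> y" "V \<in> y" for y
  proof
    fix U assume U: "U \<in> y"
    show "U \<in> x"
    proof (rule ccontr)
      have U': "openin S U" using cpf_open[OF y(1) U] .
      assume "U \<notin> x"
      then have "U \<subseteq> P" using notin_cpf_iff[OF x U'] by (simp add: P_def)
      then have "P \<in> y" using cpf_mono[OF y(1) U P(1)] by blast
      then have "V \<inter> P \<in> y" using cpf_Int[OF y(1) V(1) P(1)] y by blast
      then show False using cpf_mono[OF y(1) _ B V(2)] y by blast
    qed
  qed
  ultimately have "weakly_isolated_in (soberification S) F x"
    unfolding weakly_isolated_in_def
    using xF x V
    by (intro conjI exI[of _ "{y. completely_prime_filter (opens S) y \<and> V \<in> y}"])
      (auto simp: closure_of_soberification openin_soberification F)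
  then show "\<exists>x. weakly_isolated_in (soberification S) F x" ..
qed

section \<open>Sobriety\<close>

lemma weakly_scattered_homeomorphic:
  assumes h: "homeomorphic_map X Y h" and ws: "weakly_scattered X"
  shows "weakly_scattered Y"
  unfolding weakly_scattered_def
proof (intro allI impI, elim conjE)
  fix F assume F: "closedin Y F" "F \<noteq> {}"
  have hX: "h ` topspace X = topspace Y"
    using homeomorphic_imp_surjective_map[OF h] .
  define E where "E = {x \<in> topspace X. h x \<in> F}"
  have hE: "h ` E = F"
    using hX closedin_subset[OF F(1)] by (auto simp: E_def)
  have "closedin X E"
    using closedin_continuous_map_preimage[OF homeomorphic_imp_continuous_map[OF h] F(1)]
    by (simp add: E_def)
  moreover have "E \<noteq> {}" using hE F by auto
  ultimately obtain x U where x: "x \<in> E" and U: "openin X U" "x \<in> U"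
      and sub: "E \<inter> U \<subseteq> X closure_of {x}"
    using ws unfolding weakly_scattered_def weakly_isolated_in_def by blast
  have xX: "x \<in> topspace X" using x by (simp add: E_def)
  have "F \<inter> h ` U \<subseteq> h ` (E \<inter> U)"
    using openin_subset[OF U(1)] by (auto simp: E_def)
  also have "\<dots> \<subseteq> h ` (X closure_of {x})" using sub by blast
  also have "\<dots> = Y closure_of {h x}"
    using homeomorphic_map_closure_of[OF h, of "{x}"] xX by simp
  finally have "weakly_isolated_in Y F (h x)"
    unfolding weakly_isolated_in_def
    using x hE U homeomorphic_imp_open_map[OF h] by (auto simp: open_map_def)
  then show "\<exists>y. weakly_isolated_in Y F y" ..
qed

lemma sober_weakly_scattered_iff:
  assumes "sober S"
  shows "weakly_scattered (soberification S) \<longleftrightarrow> weakly_scattered S"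
proof -
  have "homeomorphic_map S (soberification S) (\<lambda>s. {U. openin S U \<and> s \<in> U})"
    using assms by (simp add: sober_def)
  moreover from this obtain g where "homeomorphic_map (soberification S) S g"
    unfolding homeomorphic_map_maps by (blast dest: homeomorphic_maps_sym[THEN iffD1])
  ultimately show ?thesis
    by (blast intro: weakly_scattered_homeomorphic)
qed

text \<open>The T0 axiom gives injectivity of the map into the soberification. For surjectivity, a
  point \<open>x\<close> is the neighbourhood filter of any weakly isolated point of the complement
  of its prime open set.\<close>

lemma weakly_scattered_imp_sober:
  assumes t0: "t0_space S" and ws: "weakly_scattered S"
  shows "sober S"
proof -
  define e where "e = (\<lambda>s. {U. openin S U \<and> s \<in> U})"
  have e: "completely_prime_filter (opens S) (e s)" if "s \<in> topspace S" for s
    using cpf_neighbourhoods[OF that] by (simp add: e_def)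
  have surj: "\<exists>s\<in>topspace S. x = e s" if x: "completely_prime_filter (opens S) x" for x
  proof -
    define P where "P = prime_open S x"
    have P: "openin S P" "P \<notin> x"
      using prime_open_notin[OF x] by (auto simp: P_def)
    have iff: "U \<notin> x \<longleftrightarrow> U \<subseteq> P" if "openin S U" for U
      using notin_cpf_iff[OF x that] by (simp add: P_def)
    have "\<not> topspace S \<subseteq> P"
      using iff[of "topspace S"] cpf_topspace[OF x] by auto
    then have "closedin S (topspace S - P)" "topspace S - P \<noteq> {}"
      using P by auto
    then obtain s W where s: "s \<in> topspace S" "s \<notin> P" and W: "openin S W" "s \<in> W"
        and sub: "(topspace S - P) \<inter> W \<subseteq> S closure_of {s}"
      using ws unfolding weakly_scattered_def weakly_isolated_in_def by blast
    have "W \<in> x" using iff[OF W(1)] W s by blast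
    \<comment> \<open>If \<open>U\<close> is in \<open>x\<close>, so is \<open>U \<inter> W\<close>,
      which therefore has a point outside \<open>P\<close>. That point is in the closure of
      \<open>s\<close>, so \<open>U\<close> contains \<open>s\<close>.\<close>
    have "U \<in> x \<longleftrightarrow> s \<in> U" if U: "openin S U" for U
    proof
      assume "s \<in> U" then show "U \<in> x" using iff[OF U] s by blast
    next
      assume "U \<in> x"
      with \<open>W \<in> x\<close> have "U \<inter> W \<in> x" using cpf_Int[OF x U W(1)] by blast
      then obtain t where t: "t \<in> U" "t \<in> W" "t \<notin> P"
        using iff[of "U \<inter> W"] U W by auto
      then have "t \<in> S closure_of {s}"
        using sub openin_subset[OF U] by blast
      then show "s \<in> U" using t U by (auto simp: in_closure_of)
    qed
    then have "x = e s" using cpf_open[OF x] by (auto simp: e_def)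
    with s show ?thesis by blast
  qed
  have im: "e ` topspace S = topspace (soberification S)"
    using e surj by (auto simp: topspace_soberification)
  have imU: "e ` U = {x. completely_prime_filter (opens S) x \<and> U \<in> x}" if U: "openin S U" for U
    using e surj U openin_subset[OF U] by (fastforce simp: e_def)
  have "continuous_map S (soberification S) e"
    unfolding continuous_map_def
  proof (intro conjI allI impI)
    show "e \<in> topspace S \<rightarrow> topspace (soberification S)" using im by blast
    fix V assume "openin (soberification S) V"
    then obtain U where U: "openin S U" "V = {x. completely_prime_filter (opens S) x \<and> U \<in> x}"
      by (auto simp: openin_soberification)
    then have "{s \<in> topspace S. e s \<in> V} = U"
      using e openin_subset[OF U(1)] by (auto simp: e_def)
    with U show "openin S {s \<in> topspace S. e s \<in> V}" by simp
  qed
  moreover have "open_map S (soberification S) e"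
    unfolding open_map_def using imU by (auto simp: openin_soberification)
  moreover have "inj_on e (topspace S)"
  proof (rule inj_onI, rule ccontr)
    fix s t assume st: "s \<in> topspace S" "t \<in> topspace S" "e s = e t" "s \<noteq> t"
    then obtain U where "openin S U" "(s \<notin> U) = (t \<in> U)"
      using t0 unfolding t0_space_def by blast
    with st(3) show False by (auto simp: e_def set_eq_iff)
  qed
  ultimately have "homeomorphic_map S (soberification S) e"
    using im by (intro bijective_open_imp_homeomorphic_map)
  then show ?thesis by (simp add: sober_def e_def)
qed

theorem theorem7p6:
  fixes S :: "'a topology"
  shows "(spatial (nuclei (opens S)) \<longleftrightarrow> weakly_scattered (soberification S)) \<and>
    (t0_space S \<longrightarrow> (sober S \<and> spatial (nuclei (opens S)) \<longleftrightarrow> weakly_scattered S)) \<and>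
    (sober S \<longrightarrow> (spatial (nuclei (opens S)) \<longleftrightarrow> weakly_scattered S))"
proof -
  have "spatial (nuclei (opens S)) \<longleftrightarrow> weakly_scattered (soberification S)"
    using spatial_imp_weakly_scattered[of S] weakly_scattered_imp_spatial[of S] by blast
  then show ?thesis
    using sober_weakly_scattered_iff[of S] weakly_scattered_imp_sober[of S] by blast
qed

end
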